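(* Let $G_0$, $G_1$ and $G_2$ be any three finite simple connected graphs, and let $\epsilon(G_0\vee(G_1\cup G_2))$ be the eccentricity matrix of the join of $G_0$ with the disjoint union of $G_1$ and $G_2$. 1. If $G_0$ is self-centered and $\mathrm{diam}(G_0)=2$, then $\epsilon(G_0\vee(G_1\cup G_2))$ is reducible. 2. If $G_0$ is not self-centered and $\mathrm{diam}(G_0)=2$, then $\epsilon(G_0\vee(G_1\cup G_2))$ is irreducible. 3. If $\mathrm{diam}(G_0)\ge 3$, then $\epsilon(G_0\vee(G_1\cup G_2))$ is reducible.
   Context: All graphs are finite, simple and undirected. $G\cup H$ denotes the disjoint union of $G$ and $H$, and the join $G\vee H$ is obtained from $G\cup H$ by joining every vertex of $G$ to every vertex of $H$. For a connected graph $G$ with distance function $d$, the eccentricity of a vertex $v$ is $e(v)=\max\{d(v,u):u\in V(G)\}$; the radius and diameter $\mathrm{diam}(G)$ are the minimum and maximum vertex eccentricities, and $G$ is self-centered if its radius equals its diameter. The eccentricity matrix $\epsilon(G)$ is the symmetric matrix indexed by $V(G)$ with $(u,v)$ entry $d(u,v)$ if $d(u,v)=\min\{e(u),e(v)\}$, and $0$ otherwise. A square matrix $N$ is reducible if there is a permutation matrix $P$ with $N=P^T\begin{pmatrix}A&B\\0&C\end{pmatrix}P$, where $A$ and $C$ are (nonempty) square blocks; it is irreducible otherwise. *)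

theory Defs
  imports
    "Graph_Theory.Digraph_Component"
    "Graph_Theory.Pair_Digraph"
    "Graph_Theory.Shortest_Path"
    "Jordan_Normal_Form.Matrix"
    "HOL-Combinatorics.Permutations"
begin

text \<open>
  A finite simple undirected graph is a \<^locale>\<open>pair_graph\<close>: a finite, symmetric, loop-free
  relation on a finite vertex set. Connectedness is the constant connected of Digraph_Component; it
  includes that the vertex set is nonempty.
\<close>

section \<open>Disjoint union and join\<close>

text \<open>The vertex sets are made disjoint by tagging them in a sum type.\<close>

definition graph_union :: "'a pair_pre_digraph \<Rightarrow> 'b pair_pre_digraph \<Rightarrow> ('a + 'b) pair_pre_digraph"
  where "graph_union G H =
    \<lparr> pverts = Inl ` pverts G \<union> Inr ` pverts H,
      parcs = map_prod Inl Inl ` parcs G \<union> map_prod Inr Inr ` parcs H \<rparr>"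

definition graph_join :: "'a pair_pre_digraph \<Rightarrow> 'b pair_pre_digraph \<Rightarrow> ('a + 'b) pair_pre_digraph"
  where "graph_join G H =
    \<lparr> pverts = pverts (graph_union G H),
      parcs = parcs (graph_union G H)
        \<union> Inl ` pverts G \<times> Inr ` pverts H
        \<union> Inr ` pverts H \<times> Inl ` pverts G \<rparr>"

lemma pair_graph_union:
  assumes "pair_graph G" "pair_graph H"
  shows "pair_graph (graph_union G H)"
proof -
  interpret G: pair_graph G by fact
  interpret H: pair_graph H by fact
  show ?thesis
  proof
    show "symmetric (with_proj (graph_union G H))"
      using G.sym_arcs H.sym_arcs
      by (auto simp: graph_union_def symmetric_def sym_def map_prod_def image_iff; force)
  qed (auto simp: graph_union_def dest: G.wellformed' H.wellformed' G.pair_no_loops H.pair_no_loops)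
qed

lemma pair_graph_join:
  assumes "pair_graph G" "pair_graph H"
  shows "pair_graph (graph_join G H)"
proof -
  interpret G: pair_graph G by fact
  interpret H: pair_graph H by fact
  interpret U: pair_graph "graph_union G H" by (rule pair_graph_union) fact+
  have V: "pverts (graph_union G H) = Inl ` pverts G \<union> Inr ` pverts H"
    by (simp add: graph_union_def)
  show ?thesis
  proof
    show "symmetric (with_proj (graph_join G H))"
      using U.sym_arcs by (auto simp: graph_join_def symmetric_def sym_def)
  qed (use U.pair_finite_verts U.pair_finite_arcs in
      \<open>auto simp: graph_join_def V dest: U.wellformed' U.pair_no_loops\<close>)
qed

section \<open>Eccentricity\<close>

text \<open>
  The distance is the least number of edges of a walk, i.e. the library's shortest-path cost for the
  constant weight 1. It takes values in the extended reals, and is infinite exactly between vertices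
  that are not joined by a walk.
\<close>

definition graph_dist :: "'a pair_pre_digraph \<Rightarrow> 'a \<Rightarrow> 'a \<Rightarrow> ereal"
  where "graph_dist G u v = wf_digraph.\<mu> (with_proj G) (\<lambda>_. 1) u v"

definition eccentricity :: "'a pair_pre_digraph \<Rightarrow> 'a \<Rightarrow> ereal"
  where "eccentricity G v = Max {graph_dist G v u | u. u \<in> pverts G}"

definition radius :: "'a pair_pre_digraph \<Rightarrow> ereal"
  where "radius G = Min (eccentricity G ` pverts G)"

definition diam :: "'a pair_pre_digraph \<Rightarrow> ereal"
  where "diam G = Max (eccentricity G ` pverts G)"

definition self_centered :: "'a pair_pre_digraph \<Rightarrow> bool"
  where "self_centered G \<longleftrightarrow> radius G = diam G"

text \<open>
  Matrices of \<^theory>\<open>Jordan_Normal_Form.Matrix\<close> are indexed by natural numbers, so the matrix indexed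
  by the vertex set is taken with respect to an enumeration \<open>vs\<close> of the vertices (a list without
  repetitions whose set is the vertex set). The finite distances occurring in a connected graph
  are converted to real numbers.
\<close>

definition ecc_matrix :: "'a pair_pre_digraph \<Rightarrow> 'a list \<Rightarrow> real mat"
  where "ecc_matrix G vs = mat (length vs) (length vs) (\<lambda>(i, j).
    if graph_dist G (vs ! i) (vs ! j) = min (eccentricity G (vs ! i)) (eccentricity G (vs ! j))
    then real_of_ereal (graph_dist G (vs ! i) (vs ! j)) else 0)"

section \<open>Reducible matrices\<close>

definition permutation_matrix :: "nat \<Rightarrow> 'a :: zero_neq_one mat \<Rightarrow> bool"
  where "permutation_matrix n P \<longleftrightarrow>
    (\<exists>\<pi>. \<pi> permutes {0..<n} \<and> P = mat n n (\<lambda>(i, j). if i = \<pi> j then 1 else 0))"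

definition reducible_matrix :: "'a :: semiring_1 mat \<Rightarrow> bool"
  where "reducible_matrix N \<longleftrightarrow>
    (\<exists>k m A B C P. 0 < k \<and> 0 < m \<and>
      A \<in> carrier_mat k k \<and> B \<in> carrier_mat k m \<and> C \<in> carrier_mat m m \<and>
      permutation_matrix (k + m) P \<and>
      N = transpose_mat P * four_block_mat A B (0\<^sub>m m k) C * P)"

definition irreducible_matrix :: "'a :: semiring_1 mat \<Rightarrow> bool"
  where "irreducible_matrix N \<longleftrightarrow> square_mat N \<and> \<not> reducible_matrix N"

end

theory Submission
  imports Defs
begin

text \<open>
  In all three cases reducibility is decided by whether \<open>G0\<close> has a dominating vertex, i.e. one of
  eccentricity less than 2; the dominating vertices of the join are exactly those of \<open>G0\<close>.
  If there is none, every vertex of the join has eccentricity at least 2, so the entries between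
  \<open>G0\<close> and \<open>G1 \<union> G2\<close>, which are at distance 1, vanish and the matrix splits into two blocks.
  A dominating vertex has eccentricity 1 in the join, so its row and column are nonzero off the
  diagonal and no proper subset of the coordinates is invariant. Its existence forces the diameter
  of \<open>G0\<close> to be at most 2, and for diameter 2 it means that \<open>G0\<close> is not self-centered.
\<close>

section \<open>Reducibility as an invariant coordinate subset\<close>

text \<open>Column \<open>j\<close> of \<open>P\<close> is the unit vector at
  \<open>\<pi> j\<close>, so in each of the two products a single summand survives: conjugation only
  relabels indices.\<close>

lemma permutation_conjugate_index:
  fixes M :: "'a :: semiring_1 mat"
  assumes M: "M \<in> carrier_mat n n" and \<pi>: "\<pi> permutes {0..<n}"
    and P: "P = mat n n (\<lambda>(i, j). if i = \<pi> j then 1 else 0)"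
    and ij: "i < n" "j < n"
  shows "(transpose_mat P * M * P) $$ (i, j) = M $$ (\<pi> i, \<pi> j)"
proof -
  have less: "\<pi> i < n" "\<pi> j < n"
    using permutes_in_image[OF \<pi>] ij by auto
  have row: "(transpose_mat P * M) $$ (i, l) = M $$ (\<pi> i, l)" if "l < n" for l
  proof -
    have "(transpose_mat P * M) $$ (i, l) = (\<Sum>k\<in>{0..<n}. (if k = \<pi> i then 1 else 0) * M $$ (k, l))"
      using M ij that unfolding P by (auto simp: scalar_prod_def intro!: sum.cong)
    also have "\<dots> = (\<Sum>k\<in>{0..<n}. if k = \<pi> i then M $$ (k, l) else 0)"
      by (rule sum.cong) auto
    finally show ?thesis using less by simp
  qed
  have "(transpose_mat P * M * P) $$ (i, j)
      = (\<Sum>l\<in>{0..<n}. (transpose_mat P * M) $$ (i, l) * (if l = \<pi> j then 1 else 0))"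
    using M ij unfolding P by (auto simp: scalar_prod_def intro!: sum.cong)
  also have "\<dots> = (\<Sum>l\<in>{0..<n}. if l = \<pi> j then M $$ (\<pi> i, l) else 0)"
    by (rule sum.cong) (auto simp: row)
  finally show ?thesis using less by simp
qed

text \<open>\<open>S\<close> and its complement are mapped bijectively onto an initial segment and
  the rest, and the two maps are glued. This moves an invariant set of coordinates into the first
  block.\<close>

lemma ex_permutes_onto_initial_segment:
  assumes "S \<subseteq> {0..<n}"
  shows "\<exists>\<pi>. \<pi> permutes {0..<n} \<and> (\<forall>i<n. i \<in> S \<longleftrightarrow> \<pi> i < card S)"
proof -
  let ?T = "{0..<n} - S"
  have fin: "finite S" using assms finite_subset by blast
  have le: "card S \<le> n" using card_mono[OF _ assms] by simp
  have cT: "card ?T = n - card S" using assms fin by (simp add: card_Diff_subset)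
  obtain f where f: "bij_betw f S {0..<card S}"
    using fin finite_same_card_bij[of S "{0..<card S}"] by auto
  obtain g where g: "bij_betw g ?T {card S..<n}"
    using cT finite_same_card_bij[of ?T "{card S..<n}"] by auto
  \<comment> \<open>The last branch fixes everything outside \<open>{0..<n}\<close>, as
    \<open>permutes\<close> demands.\<close>
  define \<pi> where "\<pi> i = (if i \<in> S then f i else if i \<in> ?T then g i else i)" for i
  have 1: "bij_betw \<pi> S {0..<card S}"
    using f by (rule iffD1[OF bij_betw_cong, rotated]) (auto simp: \<pi>_def)
  have 2: "bij_betw \<pi> ?T {card S..<n}"
    using g by (rule iffD1[OF bij_betw_cong, rotated]) (auto simp: \<pi>_def)
  have "bij_betw \<pi> (S \<union> ?T) ({0..<card S} \<union> {card S..<n})"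
    by (rule bij_betw_combine[OF 1 2]) auto
  moreover have "S \<union> ?T = {0..<n}" "{0..<card S} \<union> {card S..<n} = {0..<n}"
    using assms le by auto
  ultimately have "bij_betw \<pi> {0..<n} {0..<n}" by metis
  then have "\<pi> permutes {0..<n}"
    by (rule bij_imp_permutes) (use assms in \<open>auto simp: \<pi>_def\<close>)
  moreover have "i \<in> S \<longleftrightarrow> \<pi> i < card S" if "i < n" for i
    using bij_betwE[OF 1] bij_betwE[OF 2] that by force
  ultimately show ?thesis by blast
qed

text \<open>The coordinates in \<open>S\<close> span a subspace that \<open>N\<close> maps into
  itself. Such a set corresponds to the indices that the permutation sends into the first block,
  which removes \<open>P\<close> from all later arguments.\<close>

lemma reducible_matrix_iff:
  fixes N :: "'a :: semiring_1 mat"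
  assumes N: "N \<in> carrier_mat n n"
  shows "reducible_matrix N \<longleftrightarrow>
    (\<exists>S \<subset> {0..<n}. S \<noteq> {} \<and> (\<forall>i \<in> {0..<n} - S. \<forall>j \<in> S. N $$ (i, j) = 0))"
proof
  assume "reducible_matrix N"
  then obtain k m A B C P where km: "0 < k" "0 < m"
    and A: "A \<in> carrier_mat k k" and C: "C \<in> carrier_mat m m"
    and P: "permutation_matrix (k + m) P"
    and eq: "N = transpose_mat P * four_block_mat A B (0\<^sub>m m k) C * P"
    unfolding reducible_matrix_def by blast
  let ?M = "four_block_mat A B (0\<^sub>m m k) C"
  obtain \<pi> where \<pi>: "\<pi> permutes {0..<k + m}"
    and P_eq: "P = mat (k + m) (k + m) (\<lambda>(i, j). if i = \<pi> j then 1 else 0)"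
    using P unfolding permutation_matrix_def by blast
  have n: "n = k + m" using N unfolding eq P_eq by auto
  have M: "?M \<in> carrier_mat n n" using A C n by simp
  have im: "\<pi> i < n" if "i < n" for i
    using permutes_in_image[OF \<pi>] that n by auto
  define S where "S = {i. i < n \<and> \<pi> i < k}"
  define \<rho> where "\<rho> = inv_into UNIV \<pi>"
  have inv: "\<rho> i < n" "\<pi> (\<rho> i) = i" if "i < n" for i
    using permutes_in_image[OF permutes_inv[OF \<pi>]] permutes_inverses(1)[OF \<pi>] that \<rho>_def n by auto
  \<comment> \<open>Both blocks are nonempty: the preimage of \<open>0\<close> lies in
    \<open>S\<close>, and the preimage of \<open>k\<close>, the first index of the second block,
    does not.\<close>
  have "\<rho> 0 \<in> S" "\<rho> k \<in> {0..<n} - S"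
    using inv[of 0] inv[of k] km n unfolding S_def by auto
  moreover have "N $$ (i, j) = 0" if "i \<in> {0..<n} - S" "j \<in> S" for i j
  proof -
    have "N $$ (i, j) = ?M $$ (\<pi> i, \<pi> j)"
      unfolding eq using permutation_conjugate_index[OF M _ _, of \<pi> P i j] \<pi> P_eq n that
      by (auto simp: S_def)
    then show ?thesis using that im[of i] im[of j] A C n by (auto simp: S_def)
  qed
  ultimately show "\<exists>S \<subset> {0..<n}. S \<noteq> {} \<and> (\<forall>i \<in> {0..<n} - S. \<forall>j \<in> S. N $$ (i, j) = 0)"
    by (intro exI[of _ S]) (auto simp: S_def)
next
  assume "\<exists>S \<subset> {0..<n}. S \<noteq> {} \<and> (\<forall>i \<in> {0..<n} - S. \<forall>j \<in> S. N $$ (i, j) = 0)"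
  then obtain S where S: "S \<subset> {0..<n}" "S \<noteq> {}"
    and "\<forall>i \<in> {0..<n} - S. \<forall>j \<in> S. N $$ (i, j) = 0"
    by blast
  then have zero: "N $$ (i, j) = 0" if "i < n" "i \<notin> S" "j \<in> S" for i j
    using that by simp
  define k where "k = card S"
  define m where "m = n - k"
  have fin: "finite S" using S finite_subset by blast
  have "k < n" using psubset_card_mono[OF _ S(1)] by (simp add: k_def)
  then have km: "0 < k" "0 < m" "k + m = n"
    using S fin by (auto simp: k_def m_def card_gt_0_iff)
  obtain \<pi> where \<pi>: "\<pi> permutes {0..<n}" and \<pi>S: "\<And>i. i < n \<Longrightarrow> i \<in> S \<longleftrightarrow> \<pi> i < k"
    using ex_permutes_onto_initial_segment[of S n] S unfolding k_def by blast
  have im: "\<pi> i < n" if "i < n" for i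
    using permutes_in_image[OF \<pi>] that by auto
  define \<rho> where "\<rho> = inv_into UNIV \<pi>"
  \<comment> \<open>\<open>N\<close> is relabelled by the inverse permutation, so that conjugating
    by \<open>P\<close> gives \<open>N\<close> back; the indices of \<open>S\<close> now come
    first.\<close>
  define M where "M = mat n n (\<lambda>(i, j). N $$ (\<rho> i, \<rho> j))"
  define A where "A = mat k k (\<lambda>(i, j). M $$ (i, j))"
  define B where "B = mat k m (\<lambda>(i, j). M $$ (i, j + k))"
  define C where "C = mat m m (\<lambda>(i, j). M $$ (i + k, j + k))"
  define P where "P = mat n n (\<lambda>(i, j). if i = \<pi> j then 1 else (0 :: 'a))"
  have inv: "\<rho> i < n" "\<pi> (\<rho> i) = i" if "i < n" for i
    using permutes_in_image[OF permutes_inv[OF \<pi>]] permutes_inverses(1)[OF \<pi>] that \<rho>_def by auto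
  have "M = four_block_mat A B (0\<^sub>m m k) C"
  proof (rule eq_matI)
    fix i j
    assume "i < dim_row (four_block_mat A B (0\<^sub>m m k) C)" "j < dim_col (four_block_mat A B (0\<^sub>m m k) C)"
    then have ij: "i < n" "j < n" using km by (auto simp: A_def C_def)
    \<comment> \<open>The lower left block has rows from outside \<open>S\<close> and columns from
      \<open>S\<close>.\<close>
    have "M $$ (i, j) = 0" if "\<not> i < k" "j < k"
      using zero[of "\<rho> i" "\<rho> j"] \<pi>S inv ij that by (simp add: M_def)
    then show "M $$ (i, j) = four_block_mat A B (0\<^sub>m m k) C $$ (i, j)"
      using ij km by (auto simp: A_def B_def C_def)
  qed (use km in \<open>auto simp: M_def A_def C_def\<close>)
  moreover have "N = transpose_mat P * M * P"
  proof (rule eq_matI)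
    fix i j
    assume "i < dim_row (transpose_mat P * M * P)" "j < dim_col (transpose_mat P * M * P)"
    then have ij: "i < n" "j < n" by (auto simp: P_def)
    have "(transpose_mat P * M * P) $$ (i, j) = M $$ (\<pi> i, \<pi> j)"
      by (rule permutation_conjugate_index[OF _ \<pi> P_def ij]) (simp add: M_def)
    then show "N $$ (i, j) = (transpose_mat P * M * P) $$ (i, j)"
      using im ij permutes_inverses(2)[OF \<pi>] by (simp add: M_def \<rho>_def)
  qed (use N in \<open>auto simp: P_def\<close>)
  moreover have "permutation_matrix (k + m) P"
    using \<pi> km unfolding permutation_matrix_def P_def by blast
  ultimately show "reducible_matrix N"
    unfolding reducible_matrix_def using km
    by (intro exI[of _ k] exI[of _ m] exI[of _ A] exI[of _ B] exI[of _ C] exI[of _ P])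
      (auto simp: A_def B_def C_def)
qed

section \<open>Distances at most two\<close>

lemma graph_dist_le_length:
  assumes "pair_graph G" and "pre_digraph.awalk (with_proj G) u p v"
  shows "graph_dist G u v \<le> ereal (length p)"
proof -
  interpret pair_graph G by fact
  have "awalk_cost (\<lambda>_. 1) p = real (length p)"
    by (induction p) (auto simp: awalk_cost_def)
  then show ?thesis
    using assms(2) min_cost_le_walk_cost[of u p v "\<lambda>_. 1"] by (simp add: graph_dist_def)
qed

text \<open>The distance is an infimum over walks, so a bound for each walk suffices. Without any
  walk the infimum is infinite and the bound still holds.\<close>

lemma le_graph_dist:
  assumes "pair_graph G"
    and "\<And>p. pre_digraph.awalk (with_proj G) u p v \<Longrightarrow> n \<le> length p"
  shows "ereal n \<le> graph_dist G u v"
proof -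
  interpret pair_graph G by fact
  have "awalk_cost (\<lambda>_. 1) p = real (length p)" for p :: "('a \<times> 'a) list"
    by (induction p) (auto simp: awalk_cost_def)
  then show ?thesis
    using assms(2) by (auto simp: graph_dist_def \<mu>_def intro!: INF_greatest)
qed

lemma graph_dist_self:
  assumes "pair_graph G" "u \<in> pverts G"
  shows "graph_dist G u u = 0"
proof -
  interpret pair_graph G by fact
  show ?thesis
    using graph_dist_le_length[OF assms(1), of u "[]" u] le_graph_dist[OF assms(1), of u u 0] assms(2)
    by (auto simp: awalk_Nil_iff zero_ereal_def)
qed

lemma graph_dist_arc:
  assumes "pair_graph G" "(u, v) \<in> parcs G"
  shows "graph_dist G u v = 1"
proof -
  interpret pair_graph G by fact
  have "u \<noteq> v" using assms(2) no_loops' by blast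
  then have "1 \<le> length p" if "awalk u p v" for p
    using that by (cases p) (auto simp: awalk_Nil_iff)
  then have "ereal (real 1) \<le> graph_dist G u v"
    by (rule le_graph_dist[OF assms(1)])
  moreover have "graph_dist G u v \<le> ereal (real (length [(u, v)]))"
    by (rule graph_dist_le_length[OF assms(1)])
      (use assms(2) wellformed' in \<open>auto simp: awalk_Cons_iff awalk_Nil_iff\<close>)
  ultimately show ?thesis by (simp add: one_ereal_def)
qed

text \<open>A walk of length 0 would give \<open>u = v\<close>, and one of length 1 would be an
  arc.\<close>

lemma two_le_graph_dist:
  assumes "pair_graph G" "u \<noteq> v" "(u, v) \<notin> parcs G"
  shows "2 \<le> graph_dist G u v"
proof -
  interpret pair_graph G by fact
  have "2 \<le> length p" if "awalk u p v" for p
    using that assms(2,3)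
    by (cases p; cases "tl p") (auto simp: awalk_Cons_iff awalk_Nil_iff)
  then have "ereal (real 2) \<le> graph_dist G u v"
    by (rule le_graph_dist[OF assms(1)])
  then show ?thesis by simp
qed

lemma graph_dist_le_two:
  assumes "pair_graph G" "(u, w) \<in> parcs G" "(w, v) \<in> parcs G"
  shows "graph_dist G u v \<le> 2"
proof -
  interpret pair_graph G by fact
  have "graph_dist G u v \<le> ereal (real (length [(u, w), (w, v)]))"
    by (rule graph_dist_le_length[OF assms(1)])
      (use assms(2,3) wellformed' in \<open>auto simp: awalk_Cons_iff awalk_Nil_iff\<close>)
  then show ?thesis by simp
qed

section \<open>Dominating vertices, eccentricity and diameter\<close>

definition dominating :: "'a pair_pre_digraph \<Rightarrow> 'a \<Rightarrow> bool"
  where "dominating G v \<longleftrightarrow> v \<in> pverts G \<and> (\<forall>u \<in> pverts G. u \<noteq> v \<longrightarrow> (v, u) \<in> parcs G)"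

text \<open>No distance lies strictly between 1 and 2, so a distance below 2 means equality or
  adjacency. The bound \<open>< 2\<close> also covers the one-vertex graph, where the eccentricity
  is 0.\<close>

lemma eccentricity_less_two_iff:
  assumes G: "pair_graph G" and v: "v \<in> pverts G"
  shows "eccentricity G v < 2 \<longleftrightarrow> dominating G v"
proof -
  interpret pair_graph G by fact
  have fin: "finite {graph_dist G v u | u. u \<in> pverts G}" using pair_finite_verts by simp
  have max: "eccentricity G v < 2 \<longleftrightarrow> (\<forall>u \<in> pverts G. graph_dist G v u < 2)"
    unfolding eccentricity_def using fin v by (subst Max_less_iff) auto
  have "graph_dist G v u < 2 \<longleftrightarrow> u = v \<or> (v, u) \<in> parcs G" for u
    using two_le_graph_dist[OF G, of v u] graph_dist_arc[OF G, of v u] graph_dist_self[OF G v]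
    by (cases "u = v"; cases "(v, u) \<in> parcs G") auto
  then have "(\<forall>u \<in> pverts G. graph_dist G v u < 2) \<longleftrightarrow> dominating G v"
    using v by (auto simp: dominating_def)
  with max show ?thesis by simp
qed

lemma eccentricity_le_iff:
  assumes G: "pair_graph G" and v: "v \<in> pverts G"
  shows "eccentricity G v \<le> c \<longleftrightarrow> (\<forall>u \<in> pverts G. graph_dist G v u \<le> c)"
proof -
  interpret pair_graph G by fact
  have fin: "finite {graph_dist G v u | u. u \<in> pverts G}" using pair_finite_verts by simp
  show ?thesis
    unfolding eccentricity_def using fin v by (subst Max_le_iff) auto
qed

text \<open>The second vertex \<open>u\<close> rules out eccentricity 0.\<close>

lemma eccentricity_dominating:
  assumes G: "pair_graph G" and v: "dominating G v" and u: "u \<in> pverts G" "u \<noteq> v"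
  shows "eccentricity G v = 1"
proof (rule antisym)
  have vV: "v \<in> pverts G" using v by (simp add: dominating_def)
  show "eccentricity G v \<le> 1"
    unfolding eccentricity_le_iff[OF G vV]
  proof
    fix x assume "x \<in> pverts G"
    then show "graph_dist G v x \<le> 1"
      using v graph_dist_self[OF G vV] graph_dist_arc[OF G, of v x]
      by (cases "x = v") (auto simp: dominating_def)
  qed
  have "graph_dist G v u = 1"
    using v u graph_dist_arc[OF G, of v u] by (auto simp: dominating_def)
  \<comment> \<open>Taking the bound in \<open>eccentricity_le_iff\<close> to be the eccentricity
    itself shows that it is at least each single distance.\<close>
  then show "1 \<le> eccentricity G v"
    using eccentricity_le_iff[OF G vV, of "eccentricity G v"] u by auto
qed

text \<open>Any two vertices that are neither equal nor adjacent are joined by a path of length 2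
  through \<open>w\<close>.\<close>

lemma diam_le_two_if_dominating:
  assumes G: "pair_graph G" and w: "dominating G w"
  shows "diam G \<le> 2"
proof -
  interpret pair_graph G by fact
  have wV: "w \<in> pverts G" using w by (simp add: dominating_def)
  have "graph_dist G u v \<le> 2" if uv: "u \<in> pverts G" "v \<in> pverts G" for u v
  proof -
    have sym: "(u, w) \<in> parcs G" if "u \<noteq> w"
      using w uv that arcs_symmetric unfolding dominating_def by blast
    have "(w, v) \<in> parcs G" if "v \<noteq> w"
      using w uv that unfolding dominating_def by blast
    then consider "u = v" | "(u, v) \<in> parcs G" | "(u, w) \<in> parcs G" "(w, v) \<in> parcs G"
      using sym by (cases "u = w"; cases "v = w") auto
    then show ?thesis
      using graph_dist_self[OF G] graph_dist_arc[OF G] graph_dist_le_two[OF G] uv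
      by cases auto
  qed
  then have "eccentricity G u \<le> 2" if "u \<in> pverts G" for u
    using eccentricity_le_iff[OF G that] that by blast
  then show ?thesis
    unfolding diam_def using pair_finite_verts wV by (subst Max_le_iff) auto
qed

section \<open>Joins\<close>

lemma verts_join: "pverts (graph_join G H) = Inl ` pverts G \<union> Inr ` pverts H"
  by (simp add: graph_join_def graph_union_def)

lemma parcs_join_iff:
  "(Inl u, Inl v) \<in> parcs (graph_join G H) \<longleftrightarrow> (u, v) \<in> parcs G"
  "(Inr x, Inr y) \<in> parcs (graph_join G H) \<longleftrightarrow> (x, y) \<in> parcs H"
  "(Inl u, Inr y) \<in> parcs (graph_join G H) \<longleftrightarrow> u \<in> pverts G \<and> y \<in> pverts H"
  "(Inr x, Inl v) \<in> parcs (graph_join G H) \<longleftrightarrow> x \<in> pverts H \<and> v \<in> pverts G"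
  by (auto simp: graph_join_def graph_union_def intro: map_prod_imageI)

text \<open>The join supplies all edges to the other side, so only adjacency within the vertex's own
  side remains to be checked.\<close>

lemma dominating_join_Inl:
  "dominating (graph_join G H) (Inl v) \<longleftrightarrow> dominating G v"
  unfolding dominating_def by (auto simp: parcs_join_iff verts_join)

lemma dominating_join_Inr:
  "dominating (graph_join G H) (Inr v) \<longleftrightarrow> dominating H v"
  unfolding dominating_def by (auto simp: parcs_join_iff verts_join)

text \<open>No edge runs between the two summands, so each vertex misses every vertex of the other
  one.\<close>

lemma not_dominating_union:
  assumes "pverts G \<noteq> {}" "pverts H \<noteq> {}"
  shows "\<not> dominating (graph_union G H) v"
  using assms by (auto simp: dominating_def graph_union_def image_iff)

section \<open>The eccentricity matrix with and without a dominating vertex\<close>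

lemma ecc_matrix_index:
  assumes "i < length vs" "j < length vs"
  shows "ecc_matrix G vs $$ (i, j) =
    (if graph_dist G (vs ! i) (vs ! j) = min (eccentricity G (vs ! i)) (eccentricity G (vs ! j))
     then real_of_ereal (graph_dist G (vs ! i) (vs ! j)) else 0)"
  using assms by (simp add: ecc_matrix_def)

lemma irreducible_ecc_matrix_if_dominating:
  assumes G: "pair_graph G" and w: "dominating G w" and vs: "distinct vs" "set vs = pverts G"
  shows "irreducible_matrix (ecc_matrix G vs)"
proof -
  interpret pair_graph G by fact
  let ?N = "ecc_matrix G vs" and ?n = "length vs"
  have carrier: "?N \<in> carrier_mat ?n ?n" by (simp add: ecc_matrix_def)
  obtain a where a: "a < ?n" "vs ! a = w"
    using w vs by (metis dominating_def in_set_conv_nth)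
  have ne: "?N $$ (a, i) \<noteq> 0 \<and> ?N $$ (i, a) \<noteq> 0" if i: "i < ?n" "i \<noteq> a" for i
  proof -
    have x: "vs ! i \<in> pverts G" "vs ! i \<noteq> w"
      using i a vs nth_mem nth_eq_iff_index_eq by metis+
    have arc: "(w, vs ! i) \<in> parcs G" "(vs ! i, w) \<in> parcs G"
      using w x arcs_symmetric unfolding dominating_def by blast+
    \<comment> \<open>Hence the minimum of the two eccentricities is that of \<open>w\<close>, which
      is 1 and equals the distance: the entry is kept.\<close>
    have "1 \<le> eccentricity G (vs ! i)"
      using eccentricity_le_iff[OF G x(1), of "eccentricity G (vs ! i)"] w graph_dist_arc[OF G arc(2)]
      by (auto simp: dominating_def)
    then show ?thesis
      using a i graph_dist_arc[OF G arc(1)] graph_dist_arc[OF G arc(2)]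
        eccentricity_dominating[OF G w x]
      by (simp add: ecc_matrix_index min_def)
  qed
  have "\<not> reducible_matrix ?N"
  proof
    assume "reducible_matrix ?N"
    then obtain S where S: "S \<subset> {0..<?n}" "S \<noteq> {}"
      and "\<forall>i \<in> {0..<?n} - S. \<forall>j \<in> S. ?N $$ (i, j) = 0"
      unfolding reducible_matrix_iff[OF carrier] by blast
    then have zero: "?N $$ (i, j) = 0" if "i < ?n" "i \<notin> S" "j \<in> S" for i j
      using that by simp
    obtain i where i: "i < ?n" "i \<notin> S" using psubset_imp_ex_mem[OF S(1)] by auto
    from S(2) obtain j where "j \<in> S" by blast
    with S(1) have j: "j < ?n" "j \<in> S" by auto
    \<comment> \<open>If \<open>a\<close> is in \<open>S\<close>, its column must vanish at a row
      outside \<open>S\<close>; otherwise its row must vanish at a column in \<open>S\<close>.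
      Either contradicts \<open>ne\<close>.\<close>
    show False
    proof (cases "a \<in> S")
      case True
      with i have "i \<noteq> a" by blast
      with ne[OF i(1)] zero[OF i True] show ?thesis by simp
    next
      case False
      with j have "j \<noteq> a" by blast
      with ne[OF j(1)] zero[OF a(1) False j(2)] show ?thesis by simp
    qed
  qed
  then show ?thesis
    using carrier by (simp add: irreducible_matrix_def)
qed

lemma reducible_ecc_matrix_join:
  assumes G: "pair_graph G" "pverts G \<noteq> {}" and H: "pair_graph H" "pverts H \<noteq> {}"
    and nG: "\<And>v. \<not> dominating G v" and nH: "\<And>v. \<not> dominating H v"
    and vs: "set vs = pverts (graph_join G H)"
  shows "reducible_matrix (ecc_matrix (graph_join G H) vs)"
proof -
  let ?J = "graph_join G H" and ?n = "length vs"
  let ?N = "ecc_matrix ?J vs"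
  note J = pair_graph_join[OF G(1) H(1)]
  have carrier: "?N \<in> carrier_mat ?n ?n" by (simp add: ecc_matrix_def)
  note V = verts_join[of G H]
  have ecc: "2 \<le> eccentricity ?J x" if "x \<in> pverts ?J" for x
    using eccentricity_less_two_iff[OF J that] nG nH
    by (cases x) (auto simp: dominating_join_Inl dominating_join_Inr not_less)
  \<comment> \<open>The positions of the vertices of \<open>G\<close>; the entries to be annihilated
    are then those between the two sides of the join.\<close>
  define S where "S = {i. i < ?n \<and> vs ! i \<in> Inl ` pverts G}"
  obtain g h where gh: "g \<in> pverts G" "h \<in> pverts H" using G H by auto
  obtain i where i: "i < ?n" "vs ! i = Inl g"
    using gh vs V in_set_conv_nth[of "Inl g" vs] by auto
  obtain j where j: "j < ?n" "vs ! j = Inr h"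
    using gh vs V in_set_conv_nth[of "Inr h" vs] by auto
  have "i \<in> S" "j \<in> {0..<?n} - S" using i j gh by (auto simp: S_def)
  moreover have "?N $$ (k, l) = 0" if kl: "k \<in> {0..<?n} - S" "l \<in> S" for k l
  proof -
    have k: "k < ?n" and l: "l < ?n" using kl by (auto simp: S_def)
    have kV: "vs ! k \<in> pverts ?J" "vs ! l \<in> pverts ?J"
      using k l nth_mem vs by metis+
    then have "vs ! k \<in> Inr ` pverts H" "vs ! l \<in> Inl ` pverts G"
      using kl V by (auto simp: S_def)
    then have "(vs ! k, vs ! l) \<in> parcs ?J" by (auto simp: graph_join_def)
    then have "graph_dist ?J (vs ! k) (vs ! l) = 1" by (rule graph_dist_arc[OF J])
    moreover have "(1 :: ereal) < min (eccentricity ?J (vs ! k)) (eccentricity ?J (vs ! l))"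
      by (rule less_le_trans[of _ 2]) (use ecc kV in \<open>auto simp: min_def\<close>)
    ultimately have "graph_dist ?J (vs ! k) (vs ! l)
        \<noteq> min (eccentricity ?J (vs ! k)) (eccentricity ?J (vs ! l))"
      by (metis order_less_irrefl)
    then show ?thesis using k l by (simp add: ecc_matrix_index)
  qed
  ultimately show ?thesis
    unfolding reducible_matrix_iff[OF carrier]
    by (intro exI[of _ S]) (auto simp: S_def)
qed

theorem theorem4p9:
  fixes G0 :: "'a pair_pre_digraph"
    and G1 :: "'b pair_pre_digraph"
    and G2 :: "'c pair_pre_digraph"
    and vs :: "('a + ('b + 'c)) list"
  assumes "pair_graph G0" and "Digraph_Component.connected (with_proj G0)"
    and "pair_graph G1" and "Digraph_Component.connected (with_proj G1)"
    and "pair_graph G2" and "Digraph_Component.connected (with_proj G2)"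
    and "distinct vs" and "set vs = pverts (graph_join G0 (graph_union G1 G2))"
  shows "(self_centered G0 \<and> diam G0 = 2 \<longrightarrow>
            reducible_matrix (ecc_matrix (graph_join G0 (graph_union G1 G2)) vs)) \<and>
         (\<not> self_centered G0 \<and> diam G0 = 2 \<longrightarrow>
            irreducible_matrix (ecc_matrix (graph_join G0 (graph_union G1 G2)) vs)) \<and>
         (diam G0 \<ge> 3 \<longrightarrow>
            reducible_matrix (ecc_matrix (graph_join G0 (graph_union G1 G2)) vs))"
proof -
  interpret G0: pair_graph G0 by fact
  let ?H = "graph_union G1 G2"
  \<comment> \<open>Connectedness includes that the vertex set is nonempty.\<close>
  have ne: "pverts G0 \<noteq> {}" "pverts G1 \<noteq> {}" "pverts G2 \<noteq> {}"
    using assms(2,4,6) by (auto simp: connected_def strongly_connected_def)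
  have H: "pair_graph ?H" using assms by (intro pair_graph_union)
  have neH: "pverts ?H \<noteq> {}" using ne by (auto simp: graph_union_def)
  have fin: "finite (eccentricity G0 ` pverts G0)" "eccentricity G0 ` pverts G0 \<noteq> {}"
    using G0.pair_finite_verts ne by auto
  \<comment> \<open>The radius is an attained minimum, so the existence of a dominating vertex
    becomes a condition on the radius, comparable with the diameter.\<close>
  have rad: "radius G0 < 2 \<longleftrightarrow> (\<exists>v. dominating G0 v)"
  proof -
    have "radius G0 < 2 \<longleftrightarrow> (\<exists>v \<in> pverts G0. eccentricity G0 v < 2)"
      unfolding radius_def using Min_less_iff[OF fin, of 2] by simp
    then show ?thesis
      using eccentricity_less_two_iff[OF assms(1)] by (metis dominating_def)
  qed
  have red: "reducible_matrix (ecc_matrix (graph_join G0 ?H) vs)" if "\<not> radius G0 < 2"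
  proof (rule reducible_ecc_matrix_join[OF assms(1) ne(1) H neH _ _ assms(8)])
    show "\<not> dominating G0 v" for v using rad that by metis
    show "\<not> dominating ?H v" for v by (rule not_dominating_union[OF ne(2,3)])
  qed
  have irr: "irreducible_matrix (ecc_matrix (graph_join G0 ?H) vs)" if "radius G0 < 2"
  proof -
    obtain w where "dominating G0 w" using rad \<open>radius G0 < 2\<close> by metis
    then have "dominating (graph_join G0 ?H) (Inl w)" by (simp only: dominating_join_Inl)
    then show ?thesis
      by (rule irreducible_ecc_matrix_if_dominating[OF pair_graph_join[OF assms(1) H] _ assms(7,8)])
  qed
  have le: "radius G0 \<le> diam G0"
    unfolding radius_def diam_def by (rule Min_le[OF fin(1) Max_in[OF fin]])
  have large: "\<not> radius G0 < 2" if "diam G0 \<ge> 3"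
  proof
    assume "radius G0 < 2"
    then obtain w where "dominating G0 w" using rad by metis
    then have "diam G0 \<le> 2" by (rule diam_le_two_if_dominating[OF assms(1)])
    with that have "(3 :: ereal) \<le> 2" by (rule order_trans)
    then show False by simp
  qed
  show ?thesis
  proof (intro conjI impI; (elim conjE)?)
    assume "self_centered G0" "diam G0 = 2"
    then have "radius G0 = 2" by (simp only: self_centered_def)
    then show "reducible_matrix (ecc_matrix (graph_join G0 ?H) vs)"
      using red by (simp only: order_less_irrefl not_False_eq_True)
  next
    assume "\<not> self_centered G0" "diam G0 = 2"
    \<comment> \<open>Not being self-centered makes the radius differ from the diameter 2, and it
      cannot exceed it.\<close>
    with le have "radius G0 < 2" by (simp only: self_centered_def order_less_le simp_thms)
    then show "irreducible_matrix (ecc_matrix (graph_join G0 ?H) vs)" by (rule irr)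
  next
    assume "diam G0 \<ge> 3"
    then show "reducible_matrix (ecc_matrix (graph_join G0 ?H) vs)" by (intro red large)
  qed
qed

end
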